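(* Let $E$ be an abstract system of congruences on $n$ which is non-complementing and non-expanding. Then $E$ has a realization $\{A_0,\dots,A_{n-1}\}$ for the action of $\mathsf{PSL}_2(\mathbb{Z})$ on $\mathbb{P}^1(\mathbb{R})$ in which every $A_i$ is Borel.
   Context: $\mathsf{PSL}_2(\mathbb{Z})$ acts on $\mathbb{P}^1(\mathbb{R})\cong\mathbb{R}\cup\{\infty\}$ by fractional linear transformations $x\mapsto\frac{ax+b}{cx+d}$. For a finite set $S$, $\mathcal{P}_{\mathrm{pr}}(S)=\{R\subset S: R\neq\emptyset,\ R\neq S\}$. An abstract system of congruences on $n=\{0,\dots,n-1\}$ is an equivalence relation $E$ on $\mathcal{P}_{\mathrm{pr}}(n)$ such that $U\mathrel{E}V$ implies $\overline{U}\mathrel{E}\overline{V}$ ($\overline{U}=n\setminus U$). For an action of $\Gamma$ on $X$, $A,B\subset X$ are congruent if $\gamma\cdot A=B$ for some $\gamma\in\Gamma$; a realization of $E$ is a partition $\{A_0,\dots,A_{n-1}\}$ of $X$ such that whenever $U\mathrel{E}V$, $\bigcup_{i\in U}A_i$ and $\bigcup_{i\in V}A_i$ are congruent. $E$ is non-complementing if no $U$ satisfies $U\mathrel{E}\overline{U}$. $E$ is non-expanding if there are no $k\ge0$ and $V_0,\dots,V_k,W_0,\dots,W_k\in\mathcal{P}_{\mathrm{pr}}(n)$ with $V_i\mathrel{E}W_i$ ($i\le k$), $W_i\subset V_{i+1}$ ($i<k$), and $W_k\subsetneq V_0$. *)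

theory Defs
  imports "HOL-Analysis.Analysis" "HOL-Algebra.Group_Action"
begin

section \<open>Abstract systems of congruences\<close>

definition proper_subsets :: "'a set \<Rightarrow> 'a set set" where
  "proper_subsets S = {R. R \<subseteq> S \<and> R \<noteq> {} \<and> R \<noteq> S}"

definition congruence_system :: "nat \<Rightarrow> (nat set \<times> nat set) set \<Rightarrow> bool" where
  "congruence_system n E \<longleftrightarrow>
     equiv (proper_subsets {..<n}) E \<and>
     (\<forall>U V. (U, V) \<in> E \<longrightarrow> ({..<n} - U, {..<n} - V) \<in> E)"

definition non_complementing :: "nat \<Rightarrow> (nat set \<times> nat set) set \<Rightarrow> bool" where
  "non_complementing n E \<longleftrightarrow> (\<nexists>U. (U, {..<n} - U) \<in> E)"

definition non_expanding :: "nat \<Rightarrow> (nat set \<times> nat set) set \<Rightarrow> bool" where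
  "non_expanding n E \<longleftrightarrow>
     \<not> (\<exists>(k::nat) (V :: nat \<Rightarrow> nat set) (W :: nat \<Rightarrow> nat set).
          (\<forall>i\<le>k. V i \<in> proper_subsets {..<n} \<and> W i \<in> proper_subsets {..<n} \<and> (V i, W i) \<in> E) \<and>
          (\<forall>i<k. W i \<subseteq> V (Suc i)) \<and>
          W k \<subset> V 0)"

definition congruent_under ::
    "('g, 'r) monoid_scheme \<Rightarrow> ('g \<Rightarrow> 'x \<Rightarrow> 'x) \<Rightarrow> 'x set \<Rightarrow> 'x set \<Rightarrow> bool" where
  "congruent_under G \<phi> A B \<longleftrightarrow> (\<exists>g\<in>carrier G. \<phi> g ` A = B)"

text \<open>
  The pieces of a partition are nonempty and indexed without repetition. In particular a
  nonempty set has no partition into \<open>n = 0\<close> pieces.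
\<close>

definition realization ::
    "('g, 'r) monoid_scheme \<Rightarrow> ('g \<Rightarrow> 'x \<Rightarrow> 'x) \<Rightarrow> 'x set \<Rightarrow>
      nat \<Rightarrow> (nat set \<times> nat set) set \<Rightarrow> (nat \<Rightarrow> 'x set) \<Rightarrow> bool" where
  "realization G \<phi> X n E A \<longleftrightarrow>
     inj_on A {..<n} \<and> partition_on X (A ` {..<n}) \<and>
     (\<forall>U V. (U, V) \<in> E \<longrightarrow> congruent_under G \<phi> (\<Union>i\<in>U. A i) (\<Union>i\<in>V. A i))"


section \<open>The real projective line\<close>

datatype real_proj_line = Fin real | Infty

text \<open>The topology is that of the one-point compactification of the reals.\<close>

instantiation real_proj_line :: topological_space
begin

definition open_real_proj_line :: "real_proj_line set \<Rightarrow> bool" where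
  "open_real_proj_line U \<longleftrightarrow>
     open (Fin -` U) \<and> (Infty \<in> U \<longrightarrow> compact (- (Fin -` U)))"

instance
proof
  show "open (UNIV :: real_proj_line set)"
    by (simp add: open_real_proj_line_def)
next
  fix S T :: "real_proj_line set"
  assume "open S" "open T"
  then show "open (S \<inter> T)"
    by (auto simp: open_real_proj_line_def Compl_Int)
next
  fix K :: "real_proj_line set set"
  assume K: "\<forall>S\<in>K. open S"
  have 1: "open (Fin -` \<Union>K)"
    using K by (auto simp: open_real_proj_line_def vimage_Union)
  moreover have "compact (- (Fin -` \<Union>K))" if "Infty \<in> \<Union>K"
  proof -
    from that obtain S where S: "S \<in> K" "Infty \<in> S" by blast
    then have "compact (- (Fin -` S))" using K by (auto simp: open_real_proj_line_def)
    moreover have "closed (- (Fin -` \<Union>K))" using 1 by (simp add: closed_Compl)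
    ultimately have "compact (- (Fin -` S) \<inter> - (Fin -` \<Union>K))"
      by (rule compact_Int_closed)
    moreover have "- (Fin -` S) \<inter> - (Fin -` \<Union>K) = - (Fin -` \<Union>K)" using S by auto
    ultimately show ?thesis by simp
  qed
  ultimately show "open (\<Union>K)" by (simp add: open_real_proj_line_def)
qed

end


section \<open>The modular group and its action\<close>

definition SL2Z :: "(int^2^2) monoid" where
  "SL2Z = \<lparr>carrier = {A. det A = 1}, monoid.mult = (**), one = mat 1\<rparr>"

definition PSL2Z :: "(int^2^2) set monoid" where
  "PSL2Z = SL2Z Mod {mat 1, - mat 1}"

fun moebius :: "int^2^2 \<Rightarrow> real_proj_line \<Rightarrow> real_proj_line" where
  "moebius A (Fin x) =
     (if of_int (A$2$1) * x + of_int (A$2$2) = 0 then Infty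
      else Fin ((of_int (A$1$1) * x + of_int (A$1$2)) / (of_int (A$2$1) * x + of_int (A$2$2))))"
| "moebius A Infty =
     (if A$2$1 = 0 then Infty else Fin (of_int (A$1$1) / of_int (A$2$1)))"

text \<open>
  An element of \<open>PSL2Z\<close> is a coset \<open>{A, -A}\<close>; it acts through any of its representatives,
  see \<open>PSL2Z_act_coset\<close> below.
\<close>

definition PSL2Z_act :: "(int^2^2) set \<Rightarrow> real_proj_line \<Rightarrow> real_proj_line" where
  "PSL2Z_act C x = (THE y. \<exists>A\<in>C. y = moebius A x)"

lemma matrix_mult_2_nth:
  fixes A B :: "int^2^2"
  shows "(A ** B)$i$j = A$i$1 * B$1$j + A$i$2 * B$2$j"
  by (simp add: matrix_matrix_mult_def sum_2)

lemma group_SL2Z: "Group.group SL2Z"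
proof (rule groupI)
  fix A assume "A \<in> carrier SL2Z"
  then have d: "A$1$1 * A$2$2 - A$1$2 * A$2$1 = 1" by (simp add: SL2Z_def det_2)
  define B :: "int^2^2" where "B = vector [vector [A$2$2, - A$1$2], vector [- A$2$1, A$1$1]]"
  have "B ** A = mat 1"
    using d by (simp add: vec_eq_iff forall_2 matrix_mult_2_nth B_def mat_def algebra_simps)
  moreover have "det B = 1" using d by (simp add: det_2 B_def algebra_simps)
  ultimately show "\<exists>B\<in>carrier SL2Z. B \<otimes>\<^bsub>SL2Z\<^esub> A = \<one>\<^bsub>SL2Z\<^esub>"
    by (auto simp: SL2Z_def)
qed (auto simp: SL2Z_def det_mul matrix_mul_assoc)

lemma mat_uminus_mult:
  fixes A :: "int^2^2"
  shows "(- mat 1) ** A = - A" "A ** (- mat 1) = - A"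
  by (simp_all add: vec_eq_iff forall_2 matrix_mult_2_nth mat_def)

lemma det_uminus_2: "det (- A) = det (A :: int^2^2)"
  by (simp add: det_2)

lemma normal_SL2Z: "{mat 1, - mat 1} \<lhd> SL2Z"
proof -
  interpret group SL2Z by (rule group_SL2Z)
  have i: "inv\<^bsub>SL2Z\<^esub> (- mat 1) = - mat 1"
    by (rule inv_equality) (auto simp: SL2Z_def mat_uminus_mult det_uminus_2)
  have i1: "inv\<^bsub>SL2Z\<^esub> (mat 1) = mat 1"
    by (rule inv_equality) (auto simp: SL2Z_def)
  have "subgroup {mat 1, - mat 1} SL2Z"
  proof (rule subgroupI)
    show "{mat 1, - mat 1} \<subseteq> carrier SL2Z" by (auto simp: SL2Z_def det_uminus_2)
  next
    fix a assume "a \<in> {mat 1, - mat 1 :: int^2^2}"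
    then show "inv\<^bsub>SL2Z\<^esub> a \<in> {mat 1, - mat 1}" using i i1 by auto
  next
    fix a b assume "a \<in> {mat 1, - mat 1 :: int^2^2}" "b \<in> {mat 1, - mat 1 :: int^2^2}"
    then show "a \<otimes>\<^bsub>SL2Z\<^esub> b \<in> {mat 1, - mat 1}" by (auto simp: SL2Z_def mat_uminus_mult)
  qed simp
  then show ?thesis
    by (rule normalI) (auto simp: r_coset_def l_coset_def SL2Z_def mat_uminus_mult)
qed

lemma coset_SL2Z: "{mat 1, - mat 1} #>\<^bsub>SL2Z\<^esub> A = {A, - A}"
  by (auto simp: r_coset_def SL2Z_def mat_uminus_mult)

lemma carrier_PSL2Z: "carrier PSL2Z = {{A, - A} | A. det A = 1}"
  by (auto simp: PSL2Z_def FactGroup_def RCOSETS_def coset_SL2Z) (auto simp: SL2Z_def)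

lemma group_PSL2Z: "Group.group PSL2Z"
  unfolding PSL2Z_def by (rule normal.factorgroup_is_group[OF normal_SL2Z])

definition homogeneous :: "real \<Rightarrow> real \<Rightarrow> real_proj_line" where
  "homogeneous u v = (if v = 0 then Infty else Fin (u / v))"

lemma homogeneous_cases:
  obtains u v where "x = homogeneous u v" "u \<noteq> 0 \<or> v \<noteq> 0"
proof (cases x)
  case (Fin r)
  then show ?thesis using that[of r 1] by (simp add: homogeneous_def)
next
  case Infty
  then show ?thesis using that[of 1 0] by (simp add: homogeneous_def)
qed

lemma homogeneous_uminus: "homogeneous (- u) (- v) = homogeneous u v"
  by (simp add: homogeneous_def)

lemma moebius_homogeneous:
  assumes "u \<noteq> 0 \<or> v \<noteq> 0"
  shows "moebius A (homogeneous u v) =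
    homogeneous (of_int (A$1$1) * u + of_int (A$1$2) * v) (of_int (A$2$1) * u + of_int (A$2$2) * v)"
proof (cases "v = 0")
  case True
  then show ?thesis using assms by (simp add: homogeneous_def)
next
  case False
  then have "of_int (A$i$1) * (u / v) + of_int (A$i$2)
      = (of_int (A$i$1) * u + of_int (A$i$2) * v) / v" for i
    by (simp add: field_simps)
  then show ?thesis using False by (simp add: homogeneous_def)
qed

lemma moebius_uminus: "moebius (- A) x = moebius A x"
proof -
  obtain u v where x: "x = homogeneous u v" "u \<noteq> 0 \<or> v \<noteq> 0" by (rule homogeneous_cases)
  show ?thesis
    unfolding x(1) moebius_homogeneous[OF x(2)]
    by (subst homogeneous_uminus[symmetric]) simp
qed

lemma PSL2Z_act_coset: "PSL2Z_act {A, - A} = moebius A"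
  by (auto simp: PSL2Z_act_def moebius_uminus fun_eq_iff)

lemma moebius_one: "moebius (mat 1) x = x"
  by (cases x) (auto simp: mat_def)

lemma moebius_mult:
  assumes "det B = 1"
  shows "moebius (A ** B) x = moebius A (moebius B x)"
proof -
  obtain u v where x: "x = homogeneous u v" "u \<noteq> 0 \<or> v \<noteq> 0" by (rule homogeneous_cases)
  define u' where "u' = of_int (B$1$1) * u + of_int (B$1$2) * v"
  define v' where "v' = of_int (B$2$1) * u + of_int (B$2$2) * v"
  have d: "real_of_int (B$1$1) * of_int (B$2$2) - of_int (B$1$2) * of_int (B$2$1) = 1"
    using assms by (simp add: det_2 flip: of_int_mult of_int_diff)
  have "of_int (B$2$2) * u' - of_int (B$1$2) * v' =
      (real_of_int (B$1$1) * of_int (B$2$2) - of_int (B$1$2) * of_int (B$2$1)) * u"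
    by (simp add: u'_def v'_def algebra_simps)
  moreover have "of_int (B$1$1) * v' - of_int (B$2$1) * u' =
      (real_of_int (B$1$1) * of_int (B$2$2) - of_int (B$1$2) * of_int (B$2$1)) * v"
    by (simp add: u'_def v'_def algebra_simps)
  ultimately have "u' \<noteq> 0 \<or> v' \<noteq> 0" using x(2) d by auto
  moreover have "moebius B x = homogeneous u' v'"
    using x by (simp add: moebius_homogeneous u'_def v'_def)
  ultimately show ?thesis
    using x by (simp add: moebius_homogeneous matrix_mult_2_nth u'_def v'_def algebra_simps)
qed

lemma bij_moebius:
  assumes "det A = 1"
  shows "bij (moebius A)"
proof -
  interpret group SL2Z by (rule group_SL2Z)
  have A: "A \<in> carrier SL2Z" using assms by (simp add: SL2Z_def)
  define B where "B = inv\<^bsub>SL2Z\<^esub> A"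
  have B: "det B = 1" "A ** B = mat 1" "B ** A = mat 1"
    using inv_closed[OF A] r_inv[OF A] l_inv[OF A] by (auto simp: B_def SL2Z_def)
  show ?thesis
  proof (rule o_bij)
    show "moebius B \<circ> moebius A = id"
      by (simp add: fun_eq_iff moebius_one B assms flip: moebius_mult)
    show "moebius A \<circ> moebius B = id"
      by (simp add: fun_eq_iff moebius_one B assms flip: moebius_mult)
  qed
qed

lemma mult_PSL2Z: "{A, - A} \<otimes>\<^bsub>PSL2Z\<^esub> {B, - B} = {A ** B, - (A ** B)}"
proof -
  have "(- A) ** B = - (A ** B)" "A ** (- B) = - (A ** B)" "(- A) ** (- B) = A ** B"
    by (simp_all add: vec_eq_iff matrix_mult_2_nth)
  then show ?thesis by (auto simp: PSL2Z_def FactGroup_def set_mult_def SL2Z_def)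
qed

lemma group_action_PSL2Z: "group_action PSL2Z UNIV PSL2Z_act"
proof -
  have "PSL2Z_act \<in> hom PSL2Z (BijGroup UNIV)"
  proof (rule homI)
    fix C assume "C \<in> carrier PSL2Z"
    then show "PSL2Z_act C \<in> carrier (BijGroup UNIV)"
      by (auto simp: carrier_PSL2Z PSL2Z_act_coset BijGroup_def Bij_def bij_moebius)
  next
    fix C D assume "C \<in> carrier PSL2Z" "D \<in> carrier PSL2Z"
    then obtain A B where "C = {A, - A}" "D = {B, - B}" "det A = 1" "det B = 1"
      by (auto simp: carrier_PSL2Z)
    then show "PSL2Z_act (C \<otimes>\<^bsub>PSL2Z\<^esub> D) = PSL2Z_act C \<otimes>\<^bsub>BijGroup UNIV\<^esub> PSL2Z_act D"
      by (simp add: mult_PSL2Z PSL2Z_act_coset BijGroup_def Bij_def bij_moebius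
          compose_def moebius_mult fun_eq_iff)
  qed
  then show ?thesis
    by (simp add: group_action_def group_hom_def group_hom_axioms_def group_PSL2Z group_BijGroup)
qed

end

theory Submission
  imports Defs
begin

text \<open>
  To each \<open>(U, V) \<in> E\<close> assign an integer \<open>z(U, V)\<close>, spaced by \<open>3\<close>, and the map
  \<open>\<gamma>(U, V) x = z(V, U) - 1 / (x - z(U, V))\<close>, which sends the complement of the unit
  interval around \<open>z(U, V)\<close> into the unit interval around \<open>z(V, U)\<close>. Call \<open>(U, V)\<close> the
  label of the points of the unit interval around \<open>z(U, V)\<close> and let \<open>f\<close> be \<open>\<gamma>(U, V)\<close>
  there. Since \<open>\<gamma>(V, U)\<close> is inverse to \<open>\<gamma>(U, V)\<close>, a colouring \<open>c\<close> realizes \<open>E\<close> as soon as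
  \<open>c x \<in> U \<longleftrightarrow> c (f x) \<in> V\<close> for every \<open>x\<close> labelled \<open>(U, V)\<close>.

  Such constraints are solved for arbitrary Borel \<open>f\<close> and labels. Given \<open>c (f x)\<close>, a colour
  \<open>c x\<close> always exists, so only starting points along every forward orbit are needed. If
  consecutive labels \<open>(U, V)\<close>, \<open>(U', V')\<close> have \<open>V \<noteq> U'\<close> and \<open>V \<noteq> n - U'\<close>, then \<open>V\<close> or its
  complement meets both \<open>U'\<close> and \<open>n - U'\<close>, hence \<open>c x\<close> can be fixed before the later colours
  are known; if one such pattern recurs along the orbit, its occurrences are the starting points.
  Otherwise the labels are eventually constant, where a constant colour works, or no such
  pattern occurs from some point on. In the last case choose one positive class from each
  complementary pair of classes, which is possible as \<open>E\<close> is non-complementing, and let \<open>c x\<close>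
  lie in the positive one of \<open>U\<close> and \<open>n - U\<close>.
\<close>

section \<open>Crossing of proper subsets\<close>

lemma proper_subsets_Compl:
  "R \<in> proper_subsets S \<Longrightarrow> S - R \<in> proper_subsets S"
  by (auto simp: proper_subsets_def)

lemma proper_subsets_exists:
  assumes "R \<in> proper_subsets S"
  shows "\<exists>i\<in>S. i \<in> R \<longleftrightarrow> P"
proof (cases P)
  case True
  then show ?thesis using assms by (fastforce simp: proper_subsets_def)
next
  case False
  then show ?thesis using assms by (fastforce simp: proper_subsets_def)
qed

text \<open>Otherwise \<open>R\<close> and its complement each lie on one side of \<open>R'\<close>.
  If on the same side, \<open>R'\<close> is not proper; if on opposite sides, \<open>R\<close> is
  \<open>R'\<close> or its complement.\<close>

lemma proper_subsets_eq_or_crossing: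
  assumes "R \<in> proper_subsets S" "R' \<in> proper_subsets S" "R \<noteq> R'" "R \<noteq> S - R'"
  shows "\<exists>s. \<forall>q. \<exists>i\<in>S. (i \<in> R \<longleftrightarrow> s) \<and> (i \<in> R' \<longleftrightarrow> q)"
proof (rule ccontr)
  assume *: "\<not> ?thesis"
  obtain q where q: "\<And>i. i \<in> S \<Longrightarrow> i \<in> R \<Longrightarrow> (i \<in> R') \<noteq> q" using * by (metis (full_types))
  obtain q' where q': "\<And>i. i \<in> S \<Longrightarrow> i \<notin> R \<Longrightarrow> (i \<in> R') \<noteq> q'" using * by (metis (full_types))
  have sub: "R \<subseteq> S" "R' \<subseteq> S" using assms by (auto simp: proper_subsets_def)
  show False
  proof (cases "q = q'")
    case True
    then have "\<And>i. i \<in> S \<Longrightarrow> (i \<in> R') \<noteq> q" using q q' by blast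
    then show False using assms(2) by (cases q) (auto simp: proper_subsets_def)
  next
    case False
    then show False using q q' sub assms(3,4) by (cases q) auto
  qed
qed

section \<open>Borel colourings with prescribed constraints along a function\<close>

lemma borel_coloring_along_function:
  fixes f :: "'x::topological_space \<Rightarrow> 'x" and l c0 :: "'x \<Rightarrow> nat"
    and U V :: "nat \<Rightarrow> nat set" and T :: "nat set \<Rightarrow> bool"
  assumes f[measurable]: "f \<in> borel \<rightarrow>\<^sub>M borel"
    and l[measurable]: "l \<in> borel \<rightarrow>\<^sub>M count_space UNIV"
    and c0[measurable]: "c0 \<in> borel \<rightarrow>\<^sub>M count_space UNIV"
    and c0_less: "\<And>x. c0 x < n"
    and U: "\<And>a. a < L \<Longrightarrow> U a \<in> proper_subsets {..<n}"
    and V: "\<And>a. a < L \<Longrightarrow> V a \<in> proper_subsets {..<n}"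
    and T_UV: "\<And>a. a < L \<Longrightarrow> T (U a) \<longleftrightarrow> T (V a)"
    and T_Compl: "\<And>R. R \<in> proper_subsets {..<n} \<Longrightarrow> T ({..<n} - R) \<longleftrightarrow> \<not> T R"
  shows "\<exists>c \<in> borel \<rightarrow>\<^sub>M count_space UNIV. (\<forall>x. c x < n) \<and> (\<forall>x. l x \<ge> L \<longrightarrow> c x = c0 x) \<and>
    (\<forall>x. l x < L \<longrightarrow> (c x \<in> U (l x) \<longleftrightarrow> c (f x) \<in> V (l x)))"
proof -
  have n: "0 < n" using c0_less[of undefined] by simp
  define free where "free a b \<longleftrightarrow> a < L \<and> b < L \<and> V a \<noteq> U b \<and> V a \<noteq> {..<n} - U b" for a b

  have "\<exists>i. i < n \<and> (a < L \<longrightarrow> (i \<in> U a \<longleftrightarrow> T (U a)))" for a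
    using proper_subsets_exists[OF U] n by (cases "a < L") auto
  then obtain pos where pos: "\<And>a. pos a < n" "\<And>a. a < L \<Longrightarrow> pos a \<in> U a \<longleftrightarrow> T (U a)"
    by metis

  have "\<exists>i. i < n \<and> (a < L \<longrightarrow> (i \<in> U a \<longleftrightarrow> i \<in> V a))" for a
  proof (cases "a < L")
    case True
    have "\<exists>i<n. i \<in> U a \<longleftrightarrow> i \<in> V a"
    proof (rule ccontr)
      \<comment> \<open>A pair without such a colour consists of complementary sets, whose values
        under \<open>T\<close> would be both equal and opposite.\<close>
      assume "\<not> ?thesis"
      then have "V a = {..<n} - U a" using V[OF True] by (auto simp: proper_subsets_def)
      then show False using T_UV[OF True] T_Compl[OF U[OF True]] by simp
    qed
    then show ?thesis by blast
  qed (use n in auto)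
  then obtain stay where stay: "\<And>a. stay a < n" "\<And>a. a < L \<Longrightarrow> stay a \<in> U a \<longleftrightarrow> stay a \<in> V a"
    by metis

  have "\<exists>i. i < n \<and> (a < L \<longrightarrow> (i \<in> U a \<longleftrightarrow> j \<in> V a))" for a j
    using proper_subsets_exists[OF U] n by (cases "a < L") auto
  then obtain pull where pull: "\<And>a j. pull a j < n"
      "\<And>a j. a < L \<Longrightarrow> pull a j \<in> U a \<longleftrightarrow> j \<in> V a"
    by metis

  \<comment> \<open>The order of the quantifiers matters: \<open>i\<close> is fixed before the
    colour \<open>j\<close> two points later, and only the colour \<open>t j\<close> in between
    adapts to \<open>j\<close>.\<close>
  have "\<exists>i t. i < n \<and> (\<forall>j. t j < n \<and>
      (free a b \<longrightarrow> (i \<in> U a \<longleftrightarrow> t j \<in> V a) \<and> (t j \<in> U b \<longleftrightarrow> j \<in> V b)))" for a b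
  proof (cases "free a b")
    case True
    then have ab: "a < L" "b < L" by (auto simp: free_def)
    obtain s where s: "\<And>q. \<exists>i\<in>{..<n}. (i \<in> V a \<longleftrightarrow> s) \<and> (i \<in> U b \<longleftrightarrow> q)"
      using proper_subsets_eq_or_crossing[OF V[OF ab(1)] U[OF ab(2)]] True
      by (auto simp: free_def)
    obtain i where i: "i < n" "i \<in> U a \<longleftrightarrow> s" using proper_subsets_exists[OF U[OF ab(1)]] by auto
    from s have "\<forall>j. \<exists>t. t < n \<and> (t \<in> V a \<longleftrightarrow> s) \<and> (t \<in> U b \<longleftrightarrow> j \<in> V b)" by (metis lessThan_iff)
    then show ?thesis using i by metis
  qed (use n in auto)
  then obtain start link where
    start: "\<And>a b. start a b < n" and
    link: "\<And>a b j. link a b j < n"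
      "\<And>a b j. free a b \<Longrightarrow> start a b \<in> U a \<longleftrightarrow> link a b j \<in> V a"
      "\<And>a b j. free a b \<Longrightarrow> link a b j \<in> U b \<longleftrightarrow> j \<in> V b"
    by metis

  \<comment> \<open>Patterns are coded by natural numbers, so that \<open>LEAST\<close> selects a
    recurring one measurably.\<close>
  define pa where "pa p = fst (prod_decode p)" for p
  define pb where "pb p = snd (prod_decode p)" for p
  \<comment> \<open>The third letter of the pattern is restricted only to keep occurrences at consecutive
    points apart.\<close>
  define occ where "occ p x \<longleftrightarrow> free (pa p) (pb p) \<and> l x = pa p \<and> l (f x) = pb p \<and>
    (pa p \<noteq> pb p \<or> l (f (f x)) \<noteq> pb p)" for p x
  define rec where "rec p x \<longleftrightarrow> (\<forall>m. \<exists>k\<ge>m. occ p ((f ^^ k) x))" for p x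
  \<comment> \<open>The selection is constant along orbits. If nothing recurs its value is
    arbitrary, but then \<open>reset\<close> never holds.\<close>
  define s where "s x = (LEAST p. rec p x)" for x
  define rigid where "rigid x \<longleftrightarrow> (\<forall>k. \<not> free (l ((f ^^ k) x)) (l ((f ^^ Suc k) x)) \<and>
    l ((f ^^ k) x) < L)" for x
  define const where "const x \<longleftrightarrow> \<not> rigid x \<and> (\<forall>k. l ((f ^^ k) x) = l x)" for x
  define reset where "reset x \<longleftrightarrow> rec (s x) x \<and> occ (s x) x" for x
  define stop where "stop x \<longleftrightarrow> l x \<ge> L \<or> rigid x \<or> const x \<or> reset x" for x
  define h where "h x = (LEAST k. stop ((f ^^ k) x))" for x
  define base where "base x = (if l x \<ge> L then c0 x else if rigid x then pos (l x)
    else if const x then stay (l x) else start (pa (s x)) (pb (s x)))" for x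
  \<comment> \<open>A point labelled \<open>pb p\<close> may directly follow a reset. There
    \<open>link\<close> meets the constraint of the predecessor as well as its own; elsewhere it
    still meets its own.\<close>
  define step where "step p b j = (if free (pa p) (pb p) \<and> b = pb p then link (pa p) (pb p) j
    else pull b j)" for p b j
  \<comment> \<open>Backward recursion along the orbit: \<open>C k x\<close> is the colour of
    \<open>x\<close> if the first stop is \<open>k\<close> steps ahead.\<close>
  define C where "C = rec_nat base (\<lambda>_ r x. step (s x) (l x) (r (f x)))"
  define c where "c x = C (h x) x" for x
  have C_0: "C 0 x = base x" and C_Suc: "C (Suc k) x = step (s x) (l x) (C k (f x))" for k x
    by (simp_all add: C_def)

  have fk[measurable]: "f ^^ k \<in> borel \<rightarrow>\<^sub>M borel" for k
    by (induction k) (simp_all only: funpow.simps measurable_ident measurable_comp[OF _ f])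
  have occ_m[measurable]: "Measurable.pred borel (occ p)" for p
    unfolding occ_def by measurable
  have rec_m[measurable]: "Measurable.pred borel (rec p)" for p
    unfolding rec_def by measurable
  have s_m[measurable]: "s \<in> borel \<rightarrow>\<^sub>M count_space UNIV"
    unfolding s_def by measurable
  have rigid_m[measurable]: "Measurable.pred borel rigid"
    unfolding rigid_def by measurable
  have const_m[measurable]: "Measurable.pred borel const"
  proof -
    \<comment> \<open>Equality of two labels is split over the countably many values, each giving a
      Borel condition.\<close>
    have eq: "const = (\<lambda>x. \<not> rigid x \<and> (\<forall>k. \<exists>a. l ((f ^^ k) x) = a \<and> l x = a))"
      by (auto simp: const_def)
    show ?thesis unfolding eq by measurable
  qed
  have reset_m[measurable]: "Measurable.pred borel reset"
    unfolding reset_def by measurable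
  have stop_m[measurable]: "Measurable.pred borel stop"
    unfolding stop_def by measurable
  have h_m[measurable]: "h \<in> borel \<rightarrow>\<^sub>M count_space UNIV"
    unfolding h_def by measurable
  have base_m[measurable]: "base \<in> borel \<rightarrow>\<^sub>M count_space UNIV"
    unfolding base_def by measurable
  have C_m[measurable]: "C k \<in> borel \<rightarrow>\<^sub>M count_space UNIV" for k
  proof (induction k)
    case 0
    then show ?case using base_m by (simp add: C_0[abs_def] C_def)
  next
    case (Suc k)
    note Suc[measurable]
    have "(\<lambda>x. step (s x) (l x) (C k (f x))) \<in> borel \<rightarrow>\<^sub>M count_space UNIV" by measurable
    then show ?case by (simp add: C_def)
  qed
  have c_m: "c \<in> borel \<rightarrow>\<^sub>M count_space UNIV"
    unfolding c_def by measurable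

  have rec_f: "rec p (f x) \<longleftrightarrow> rec p x" for p x
  proof -
    have "rec p (f x) \<longleftrightarrow> (\<forall>m. \<exists>k\<ge>m. occ p ((f ^^ Suc k) x))"
      by (simp add: rec_def funpow_swap1)
    also have "\<dots> \<longleftrightarrow> rec p x"
      unfolding rec_def by (metis Suc_le_D Suc_le_mono le_Suc_eq)
    finally show ?thesis .
  qed
  have rec_fk: "rec p ((f ^^ k) x) \<longleftrightarrow> rec p x" for p k x
    by (induction k) (auto simp: rec_f)
  have s_f: "s (f x) = s x" for x by (simp add: s_def rec_f)
  have s_fk: "s ((f ^^ k) x) = s x" for k x by (induction k) (auto simp: s_f)

  have exists_stop: "\<exists>k. stop ((f ^^ k) x)" for x
  proof (rule ccontr)
    assume "\<not> ?thesis"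
    then have no: "\<not> stop ((f ^^ k) x)" for k by blast
    define w where "w k = l ((f ^^ k) x)" for k
    have w: "w k < L" for k using no[of k] by (auto simp: stop_def w_def)
    have w_add: "l ((f ^^ i) ((f ^^ k) x)) = w (i + k)" for i k by (simp add: w_def funpow_add)
    have not_rec: "\<not> rec p x" for p
    proof
      assume "rec p x"
      then have r: "rec (s x) x" unfolding s_def by (rule LeastI)
      then obtain k where "occ (s x) ((f ^^ k) x)" unfolding rec_def by blast
      then have "reset ((f ^^ k) x)" using r by (simp add: reset_def s_fk rec_fk)
      then show False using no[of k] by (simp add: stop_def)
    qed
    \<comment> \<open>There are finitely many pairs of labels below \<open>L\<close>, so one bound
      \<open>N\<close> serves for all patterns.\<close>
    then have "\<forall>p\<in>prod_encode ` ({..<L} \<times> {..<L}). \<forall>\<^sub>F k in sequentially. \<not> occ p ((f ^^ k) x)"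
      unfolding rec_def eventually_sequentially by blast
    then have "\<forall>\<^sub>F k in sequentially. \<forall>p\<in>prod_encode ` ({..<L} \<times> {..<L}). \<not> occ p ((f ^^ k) x)"
      by (subst eventually_ball_finite_distrib) auto
    then obtain N where N: "\<And>k a b. k \<ge> N \<Longrightarrow> a < L \<Longrightarrow> b < L \<Longrightarrow> \<not> occ (prod_encode (a, b)) ((f ^^ k) x)"
      unfolding eventually_sequentially by blast
    \<comment> \<open>A free pair that is not an occurrence violates the condition on the third
      letter. Hence the label repeats, the next pair is free again, and by induction the labels stay
      constant.\<close>
    have rep: "w (Suc k) = w k \<and> w (Suc (Suc k)) = w k" if "k \<ge> N" "free (w k) (w (Suc k))" for k
      using N[OF that(1) w[of k] w[of "Suc k"]] that(2)
      by (auto simp: occ_def pa_def pb_def w_def)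
    show False
    proof (cases "\<exists>k\<ge>N. free (w k) (w (Suc k))")
      case True
      then obtain k where k: "k \<ge> N" "free (w k) (w (Suc k))" by blast
      have "w (i + k) = w k \<and> w (Suc (i + k)) = w k" for i
      proof (induction i)
        case 0
        then show ?case using rep[OF k] by simp
      next
        case (Suc i)
        then have "free (w (i + k)) (w (Suc (i + k)))" using k rep[OF k] by simp
        then show ?case using rep[of "i + k"] k Suc by simp
      qed
      then have "const ((f ^^ k) x) \<or> rigid ((f ^^ k) x)"
        unfolding const_def w_add by (simp add: w_def)
      then show False using no[of k] by (auto simp: stop_def)
    next
      case False
      then have "rigid ((f ^^ N) x)"
        unfolding rigid_def w_add using w by simp
      then show False using no[of N] by (simp add: stop_def)
    qed
  qed

  \<comment> \<open>Verification of the constraints\<close>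
  have c_stop: "c x = base x" if "stop x" for x
    using that by (simp add: c_def h_def C_0 Least_eq_0)
  have c_step: "c x = step (s x) (l x) (c (f x))" if "\<not> stop x" for x
  proof -
    obtain k where "stop ((f ^^ k) x)" using exists_stop by blast
    then have "h x = Suc (h (f x))"
      unfolding h_def using that
      by (subst Least_Suc[where n = k]) (auto simp: funpow_swap1)
    then show ?thesis by (simp add: c_def C_Suc)
  qed
  have base_less: "base x < n" for x
    by (simp add: base_def c0_less pos stay start)
  have step_less: "step p b j < n" for p b j
    by (simp add: step_def link pull)
  have c_less: "c x < n" for x
    using c_stop[of x] c_step[of x] base_less step_less by (cases "stop x") auto

  have "c x \<in> U (l x) \<longleftrightarrow> c (f x) \<in> V (l x)" if lx: "l x < L" for x
  proof -
    consider (rigid) "rigid x" | (const) "const x" | (reset) "reset x" "\<not> rigid x" "\<not> const x"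
      | (step) "\<not> stop x"
      using lx by (auto simp: stop_def)
    then show ?thesis
    proof cases
      case rigid
      have "rigid (f x)"
        unfolding rigid_def
        using rigid[unfolded rigid_def, rule_format, of "Suc k" for k] by (simp add: funpow_swap1)
      moreover have lfx: "l (f x) < L" and nf: "\<not> free (l x) (l (f x))"
        using rigid[unfolded rigid_def, rule_format, of 0]
          rigid[unfolded rigid_def, rule_format, of 1] by auto
      ultimately have c: "c x = pos (l x)" "c (f x) = pos (l (f x))"
        using rigid lx by (simp_all add: c_stop stop_def base_def)
      have "V (l x) = U (l (f x)) \<or> V (l x) = {..<n} - U (l (f x))"
        using nf lx lfx by (simp add: free_def)
      \<comment> \<open>Passing from \<open>U (l (f x))\<close> to its complement flips both
        membership and \<open>T\<close>, so positivity of the chosen side survives in either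
        case.\<close>
      then show ?thesis
        using c pos lx lfx T_UV[OF lx] T_Compl[OF U[OF lfx]] by auto
    next
      case const
      then have eq: "l ((f ^^ k) x) = l x" for k by (simp add: const_def)
      have eq': "l ((f ^^ k) (f x)) = l x" for k using eq[of "Suc k"] by (simp add: funpow_swap1)
      have lfx: "l (f x) = l x" using eq[of 1] by simp
      have "\<not> rigid (f x)"
        using const eq' unfolding const_def rigid_def eq by (metis funpow_0)
      then have "const (f x)" using eq' lfx by (simp add: const_def)
      then have "c x = stay (l x)" "c (f x) = stay (l x)"
        using const lx lfx by (simp_all add: c_stop stop_def base_def const_def)
      then show ?thesis using stay lx by simp
    next
      case reset
      let ?a = "pa (s x)" and ?b = "pb (s x)"
      have r: "rec (s x) x" and o: "occ (s x) x" using reset by (auto simp: reset_def)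
      have ab: "free ?a ?b" "l x = ?a" "l (f x) = ?b" using o by (auto simp: occ_def)
      have lfx: "l (f x) < L" using ab by (simp add: free_def)
      \<comment> \<open>The next point must not be a stop. A later occurrence contains a free pair,
        so \<open>f x\<close> is not rigid, and its letters are not all equal, so \<open>f x\<close>
        is not constant.\<close>
      obtain k where k: "k \<ge> 1" "occ (s x) ((f ^^ k) x)" using r unfolding rec_def by blast
      then obtain i where "k = Suc i" by (cases k) auto
      then have i: "occ (s x) ((f ^^ i) (f x))" using k by (simp add: funpow_swap1)
      have "\<not> rigid (f x)"
        using i unfolding rigid_def occ_def by (auto intro!: exI[of _ i])
      moreover have "\<not> const (f x)"
      proof
        assume "const (f x)"
        then have e: "l ((f ^^ m) (f x)) = l (f x)" for m by (simp add: const_def)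
        have "l ((f ^^ i) (f x)) = l (f x)" "l (f ((f ^^ i) (f x))) = l (f x)"
          "l (f (f ((f ^^ i) (f x)))) = l (f x)"
          using e[of i] e[of "Suc i"] e[of "Suc (Suc i)"] by simp_all
        then show False using i by (auto simp: occ_def)
      qed
      moreover have "\<not> reset (f x)"
        using o by (auto simp: reset_def s_f occ_def)
      ultimately have "\<not> stop (f x)" using lfx by (simp add: stop_def)
      then have "c (f x) = link ?a ?b (c (f (f x)))"
        using ab by (simp add: c_step step_def s_f)
      moreover have "c x = start ?a ?b"
        using reset lx by (simp add: c_stop stop_def base_def)
      ultimately show ?thesis using link(2)[OF ab(1)] ab(2) by simp
    next
      case step
      then show ?thesis
        using link(3) pull(2)[OF lx] by (auto simp: c_step step_def)
    qed
  qed
  moreover have "c x = c0 x" if "l x \<ge> L" for x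
    using that by (simp add: c_stop stop_def base_def)
  ultimately show ?thesis using c_m c_less by blast
qed

section \<open>Choice of positive classes\<close>

lemma class_choice:
  assumes "congruence_system n E" "non_complementing n E"
  obtains T :: "nat set \<Rightarrow> bool" where
    "\<And>R R'. (R, R') \<in> E \<Longrightarrow> T R \<longleftrightarrow> T R'"
    "\<And>R. R \<in> proper_subsets {..<n} \<Longrightarrow> T ({..<n} - R) \<longleftrightarrow> \<not> T R"
proof -
  have E: "equiv (proper_subsets {..<n}) E" using assms by (simp add: congruence_system_def)
  \<comment> \<open>The least code of a member identifies a class. The codes of \<open>R\<close> and
    its complement differ because their classes do, so comparing them makes exactly one of the two
    positive.\<close>
  define m where "m R = Inf (set_encode ` (E `` {R}))" for R
  define T where "T R \<longleftrightarrow> m R < m ({..<n} - R)" for R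
  have m_eq: "m R = m R'" if "(R, R') \<in> E" for R R'
    using equiv_class_eq[OF E that] by (simp add: m_def)
  have m_mem: "\<exists>Q. (R, Q) \<in> E \<and> Q \<subseteq> {..<n} \<and> m R = set_encode Q"
    if "R \<in> proper_subsets {..<n}" for R
  proof -
    have "R \<in> E `` {R}" using E that by (rule equiv_class_self)
    then have "m R \<in> set_encode ` (E `` {R})" unfolding m_def by (intro Inf_nat_def1) blast
    moreover have "Q \<subseteq> {..<n}" if "(R, Q) \<in> E" for Q
      using E that by (auto simp: equiv_def refl_on_def proper_subsets_def)
    ultimately show ?thesis by blast
  qed
  show ?thesis
  proof
    fix R R' assume R: "(R, R') \<in> E"
    then have "({..<n} - R, {..<n} - R') \<in> E" using assms by (simp add: congruence_system_def)
    then show "T R \<longleftrightarrow> T R'" using R m_eq by (simp add: T_def)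
  next
    fix R assume R: "R \<in> proper_subsets {..<n}"
    obtain Q where Q: "(R, Q) \<in> E" "Q \<subseteq> {..<n}" "m R = set_encode Q"
      using m_mem[OF R] by blast
    obtain Q' where Q': "({..<n} - R, Q') \<in> E" "Q' \<subseteq> {..<n}" "m ({..<n} - R) = set_encode Q'"
      using m_mem[OF proper_subsets_Compl[OF R]] by blast
    have "m R \<noteq> m ({..<n} - R)"
    proof
      assume "m R = m ({..<n} - R)"
      then have "Q = Q'"
        using Q Q' by (metis finite_lessThan finite_subset set_encode_inverse)
      then have "(R, {..<n} - R) \<in> E"
        using Q(1) Q'(1) E unfolding equiv_def by (meson symD transD)
      then show False using assms(2) by (auto simp: non_complementing_def)
    qed
    moreover have R_eq: "{..<n} - ({..<n} - R) = R" using R by (auto simp: proper_subsets_def)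
    ultimately show "T ({..<n} - R) \<longleftrightarrow> \<not> T R" unfolding T_def R_eq by linarith
  qed
qed

section \<open>Borel structure of the projective line\<close>

lemma measurable_Fin: "Fin \<in> borel \<rightarrow>\<^sub>M borel"
  by (intro borel_measurable_continuous_onI)
    (auto simp: continuous_on_open_vimage open_real_proj_line_def)

text \<open>\<open>Fin\<close> embeds the reals as an open set, hence maps Borel sets to Borel sets,
  and it misses only one point, itself Borel.\<close>

lemma sets_borel_real_proj_line:
  "A \<in> sets borel \<longleftrightarrow> Fin -` A \<in> sets borel"
proof
  assume "A \<in> sets borel"
  then show "Fin -` A \<in> sets borel" using measurable_sets[OF measurable_Fin] by simp
next
  have open_range: "open (range Fin)"
    by (auto simp: open_real_proj_line_def inj_vimage_image_eq inj_def)
  have Fin_image: "Fin ` S \<in> sets borel" if "S \<in> sets borel" for S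
  proof -
    have "S \<in> sigma_sets UNIV {S. open S}" using that by (simp add: borel_def)
    then show ?thesis
    proof induction
      case (Basic S)
      then have "open (Fin ` S)"
        by (auto simp: open_real_proj_line_def inj_vimage_image_eq inj_def)
      then show ?case by simp
    next
      case (Compl S)
      have "Fin ` (UNIV - S) = range Fin - Fin ` S" by auto
      then show ?case using Compl open_range by auto
    next
      case (Union S)
      then show ?case by (auto simp: image_UN)
    qed simp
  qed
  have "{Infty} = - range Fin" by (auto intro: real_proj_line.exhaust)
  then have Infty: "{Infty} \<in> sets borel" using open_range by auto
  assume "Fin -` A \<in> sets borel"
  then have "Fin ` (Fin -` A) \<union> (if Infty \<in> A then {Infty} else {}) \<in> sets borel"
    by (intro sets.Un Fin_image) (simp_all add: Infty)
  moreover have "Fin ` (Fin -` A) \<union> (if Infty \<in> A then {Infty} else {}) = A"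
  proof (rule Set.set_eqI)
    fix x show "x \<in> Fin ` (Fin -` A) \<union> (if Infty \<in> A then {Infty} else {}) \<longleftrightarrow> x \<in> A"
      by (cases x) auto
  qed
  ultimately show "A \<in> sets borel" by simp
qed

lemma measurable_real_proj_lineI:
  assumes "(\<lambda>r. g (Fin r)) \<in> borel \<rightarrow>\<^sub>M N" "g Infty \<in> space N"
  shows "g \<in> borel \<rightarrow>\<^sub>M N"
proof (rule measurableI)
  fix x show "g x \<in> space N"
    using assms measurable_space[OF assms(1)] by (cases x) auto
next
  fix A assume "A \<in> sets N"
  then have "(\<lambda>r. g (Fin r)) -` A \<in> sets borel" using measurable_sets[OF assms(1)] by simp
  then show "g -` A \<inter> space borel \<in> sets borel"
    by (subst sets_borel_real_proj_line) (simp add: vimage_def)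
qed

lemma measurable_moebius: "moebius A \<in> borel \<rightarrow>\<^sub>M borel"
proof (rule measurable_real_proj_lineI)
  note measurable_Fin[measurable]
  show "(\<lambda>r. moebius A (Fin r)) \<in> borel \<rightarrow>\<^sub>M borel" by simp
qed simp

section \<open>Modular maps sending the outside of one interval into another\<close>

definition swap_mat :: "int \<Rightarrow> int \<Rightarrow> int^2^2" where
  "swap_mat p q = vector [vector [q, - 1 - p * q], vector [1, - p]]"

lemma det_swap_mat: "det (swap_mat p q) = 1"
  by (simp add: swap_mat_def det_2)

lemma moebius_swap_mat:
  "moebius (swap_mat p q) (Fin r) = (if r = p then Infty else Fin (q - 1 / (r - p)))"
  "moebius (swap_mat p q) Infty = Fin q"
  by (auto simp: swap_mat_def field_simps)

declare moebius.simps [simp del]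

lemma moebius_swap_mat_inverse: "moebius (swap_mat q p) (moebius (swap_mat p q) x) = x"
  by (cases x) (auto simp: moebius_swap_mat)

definition near :: "int \<Rightarrow> real_proj_line \<Rightarrow> bool" where
  "near q x \<longleftrightarrow> (\<exists>r. x = Fin r \<and> \<bar>r - q\<bar> \<le> 1)"

lemma near_simps [simp]: "near q (Fin r) \<longleftrightarrow> \<bar>r - q\<bar> \<le> 1" "\<not> near q Infty"
  by (auto simp: near_def)

text \<open>The inversion of \<open>r - p\<close> turns a distance above 1 into one below 1 from the
  centre \<open>q\<close>, and \<open>Infty\<close> lands on \<open>q\<close> itself.\<close>

lemma near_moebius_swap_mat:
  assumes "\<not> near p x"
  shows "near q (moebius (swap_mat p q) x)"
proof (cases x)
  case (Fin r)
  then have "\<bar>r - p\<bar> > 1" using assms by simp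
  then show ?thesis using Fin by (auto simp: moebius_swap_mat field_simps abs_if split: if_splits)
qed (simp add: moebius_swap_mat)

section \<open>Construction of the realization\<close>

theorem theorem1p5:
  fixes n :: nat and E :: "(nat set \<times> nat set) set"
  assumes "n \<ge> 1"
    and "congruence_system n E"
    and "non_complementing n E"
    and "non_expanding n E"
  shows "\<exists>A :: nat \<Rightarrow> real_proj_line set.
           realization PSL2Z PSL2Z_act UNIV n E A \<and> (\<forall>i<n. A i \<in> sets borel)"
proof -
  obtain T where T: "\<And>R R'. (R, R') \<in> E \<Longrightarrow> T R \<longleftrightarrow> T R'"
    "\<And>R. R \<in> proper_subsets {..<n} \<Longrightarrow> T ({..<n} - R) \<longleftrightarrow> \<not> T R"
    using class_choice assms(2,3) by blast
  have E: "E \<subseteq> proper_subsets {..<n} \<times> proper_subsets {..<n}" "sym E"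
    using assms(2) by (auto simp: congruence_system_def equiv_def refl_on_def)
  have "finite (proper_subsets {..<n})"
    by (rule finite_subset[of _ "Pow {..<n}"]) (auto simp: proper_subsets_def)
  then have "finite E" using E(1) finite_subset by blast
  define L where "L = card E"
  obtain e where e: "bij_betw e {..<L} E"
    using ex_bij_betw_nat_finite[OF \<open>finite E\<close>] by (auto simp: L_def atLeast0LessThan)
  define U where "U a = fst (e a)" for a
  define V where "V a = snd (e a)" for a
  have eE: "(U a, V a) \<in> E" if "a < L" for a
    using bij_betwE[OF e] that by (auto simp: U_def V_def)
  \<comment> \<open>Spacing 3 makes the closed intervals of radius 1 disjoint; the shift by one
    keeps them on the positive axis.\<close>
  define ctr where "ctr a = 3 * (int a + 1)" for a
  define rev where "rev a = (SOME b. b < L \<and> e b = (V a, U a))" for a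
  have rev: "rev a < L" "U (rev a) = V a" "V (rev a) = U a" if "a < L" for a
  proof -
    have "(V a, U a) \<in> e ` {..<L}" using eE[OF that] E(2) e by (auto simp: bij_betw_def dest: symD)
    then have "\<exists>b. b < L \<and> e b = (V a, U a)" by auto
    then have "rev a < L \<and> e (rev a) = (V a, U a)" unfolding rev_def by (rule someI_ex)
    then show "rev a < L" "U (rev a) = V a" "V (rev a) = U a" by (auto simp: U_def V_def)
  qed
  have UV_inj: "a = b" if "a < L" "b < L" "U a = U b" "V a = V b" for a b
    using that e by (intro inj_onD[of e "{..<L}" a b]) (auto simp: bij_betw_def U_def V_def prod_eq_iff)
  have rev_rev: "rev (rev a) = a" if "a < L" for a
    using that by (intro UV_inj) (simp_all add: rev)
  \<comment> \<open>The alternative \<open>a = L\<close> makes the minimum exist; the value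
    \<open>L\<close> marks points outside all intervals of index below \<open>L\<close>.\<close>
  define l where "l x = (LEAST a. a = L \<or> near (ctr a) x)" for x
  have l_eq: "l x = a" if "near (ctr a) x" "a < L" for a x
    unfolding l_def
  proof (rule Least_equality)
    fix b assume b: "b = L \<or> near (ctr b) x"
    show "a \<le> b"
    proof (rule ccontr)
      assume "\<not> a \<le> b"
      then have "near (ctr b) x" "b + 1 \<le> a" using b that by auto
      moreover from this have "real b + 1 \<le> real a" by linarith
      ultimately show False using that by (auto simp: near_def ctr_def)
    qed
  qed (use that in simp)
  have l_near: "near (ctr (l x)) x" if "l x < L" for x
  proof -
    have "l x = L \<or> near (ctr (l x)) x"
      unfolding l_def by (rule LeastI[of _ L]) simp
    then show ?thesis using that by simp
  qed
  define mv where "mv a = swap_mat (ctr a) (ctr (rev a))" for a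
  define f where "f x = (if l x < L then moebius (mv (l x)) x else x)" for x
  \<comment> \<open>The negative axis carries no label, so colouring it freely makes every piece nonempty.\<close>
  define c0 where "c0 x = (case x of Fin r \<Rightarrow> let k = nat \<lfloor>- r\<rfloor> in if k < n then k else 0
    | Infty \<Rightarrow> 0)" for x
  note measurable_moebius[measurable]
  have l_m[measurable]: "l \<in> borel \<rightarrow>\<^sub>M count_space UNIV"
    by (rule measurable_real_proj_lineI) (simp_all add: l_def)
  have f_m: "f \<in> borel \<rightarrow>\<^sub>M borel" unfolding f_def by measurable
  have c0_m: "c0 \<in> borel \<rightarrow>\<^sub>M count_space UNIV"
    by (rule measurable_real_proj_lineI) (simp_all add: c0_def Let_def)
  obtain c where c_m: "c \<in> borel \<rightarrow>\<^sub>M count_space UNIV" and c_less: "\<And>x. c x < n"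
    and c_c0: "\<And>x. l x \<ge> L \<Longrightarrow> c x = c0 x"
    and c_f: "\<And>x. l x < L \<Longrightarrow> c x \<in> U (l x) \<longleftrightarrow> c (f x) \<in> V (l x)"
  proof -
    have "\<exists>c \<in> borel \<rightarrow>\<^sub>M count_space UNIV. (\<forall>x. c x < n) \<and> (\<forall>x. l x \<ge> L \<longrightarrow> c x = c0 x) \<and>
      (\<forall>x. l x < L \<longrightarrow> (c x \<in> U (l x) \<longleftrightarrow> c (f x) \<in> V (l x)))"
    proof (rule borel_coloring_along_function[OF f_m l_m c0_m, where T = T])
      show "c0 x < n" for x
        using assms(1) by (auto simp: c0_def Let_def split: real_proj_line.split)
    qed (use eE E(1) T in auto)
    then show ?thesis using that by blast
  qed
  define A where "A i = c -` {i}" for i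
  have A_Union: "(\<Union>i\<in>R. A i) = c -` R" for R by (auto simp: A_def)
  have A_nonempty: "A i \<noteq> {}" if "i < n" for i
  proof -
    have "\<not> near (ctr a) (Fin (- real i))" for a by (simp add: ctr_def)
    then have "\<not> l (Fin (- real i)) < L" using l_near by blast
    then have "c (Fin (- real i)) = i" using that by (simp add: c_c0 c0_def)
    then show ?thesis by (auto simp: A_def)
  qed
  have "inj_on A {..<n}"
  proof (rule inj_onI)
    fix i j assume "i \<in> {..<n}" "A i = A j"
    then obtain x where "x \<in> A i" "x \<in> A j" using A_nonempty[of i] by auto
    then show "i = j" by (simp add: A_def)
  qed
  moreover have "partition_on UNIV (A ` {..<n})"
  proof (rule partition_onI)
    show "\<Union> (A ` {..<n}) = UNIV" using c_less by (auto simp: A_def)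
  next
    fix p q assume "p \<in> A ` {..<n}" "q \<in> A ` {..<n}" "p \<noteq> q"
    then show "disjnt p q" by (auto simp: disjnt_def A_def)
  qed (use A_nonempty in auto)
  moreover have "congruent_under PSL2Z PSL2Z_act (\<Union>i\<in>R. A i) (\<Union>i\<in>R'. A i)"
    if RR': "(R, R') \<in> E" for R R'
  proof -
    obtain a where a: "a < L" "U a = R" "V a = R'"
    proof -
      have "(R, R') \<in> e ` {..<L}" using RR' e by (simp add: bij_betw_def)
      then obtain a where "a < L" "e a = (R, R')" by (auto simp: eq_commute)
      then show ?thesis using that by (simp add: U_def V_def)
    qed
    have iff: "c x \<in> R \<longleftrightarrow> c (moebius (mv a) x) \<in> R'" for x
    proof (cases "near (ctr a) x")
      case True
      then have "l x = a" using a by (intro l_eq)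
      then show ?thesis using c_f[of x] a by (simp add: f_def)
    next
      case False
      \<comment> \<open>Outside its interval the constraint is read at the image \<open>y\<close>:
        it lies in the interval of the reversed pair, and \<open>f\<close> sends it back to
        \<open>x\<close>.\<close>
      define y where "y = moebius (mv a) x"
      have "near (ctr (rev a)) y"
        using False by (simp add: y_def mv_def near_moebius_swap_mat)
      then have ly: "l y = rev a" using rev a by (intro l_eq)
      moreover have "moebius (mv (rev a)) y = x"
        using a by (simp add: y_def mv_def rev_rev moebius_swap_mat_inverse)
      ultimately have "f y = x" using rev a by (simp add: f_def)
      then show ?thesis using c_f[of y] ly rev a by (simp add: y_def)
    qed
    have "surj (moebius (mv a))" using bij_moebius[OF det_swap_mat] by (simp add: mv_def bij_def)
    moreover have "c -` R = moebius (mv a) -` (c -` R')" using iff by auto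
    ultimately have "moebius (mv a) ` (c -` R) = c -` R'" by (simp add: surj_image_vimage_eq)
    then have "PSL2Z_act {mv a, - mv a} ` (c -` R) = c -` R'" by (simp add: PSL2Z_act_coset)
    moreover have "{mv a, - mv a} \<in> carrier PSL2Z"
      by (auto simp: carrier_PSL2Z mv_def det_swap_mat)
    ultimately show ?thesis
      unfolding congruent_under_def A_Union by blast
  qed
  ultimately have "realization PSL2Z PSL2Z_act UNIV n E A"
    unfolding realization_def by (intro conjI allI impI)
  moreover have "A i \<in> sets borel" for i
    using measurable_sets[OF c_m, of "{i}"] by (simp add: A_def)
  ultimately show ?thesis by blast
qed

end
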